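(* Let $A_0$ be the trivial group, and let $A_{i+1}=\mathcal{J}(A_i)$ for every $i\ge 0$ (for any admissible choices of labelings at each step). Then every $A_i$ is a Jordan loop, every $A_i$ is simple, and $A_i$ is nonassociative for every $i\ge 2$.
   Context: A loop is a quasigroup (a magma in which $ax=b$ and $ya=b$ have unique solutions for all $a,b$) with a neutral element. A loop is Jordan if it is commutative and satisfies $x^2(yx)=(x^2y)x$. Inner mappings: with $L_x(y)=xy$ and $R_x(y)=yx$, put $L(x,y)=L_{yx}^{-1}L_yL_x$, $R(x,y)=R_{xy}^{-1}R_yR_x$, $T(x)=R_x^{-1}L_x$. A subloop is normal if it is invariant under all these mappings; a loop $Q$ is simple if it has no normal subloops except $\{1\}$ and $Q$. Construction of $\mathcal{J}(A)$: let $A=(A,\cdot)$ be a commutative loop of order $2^n-1\ge 1$, and let $B=\{[x_1,\dots,x_n]=[x_i] : x_i\in\{0,1\}\}$, a set of size $2^n$ disjoint from $A$. Label the elements of $A$ bijectively by symbols $(x_i)=(x_1,\dots,x_n)$, where $(x_1,\dots,x_n)$ runs over all $0$-$1$ vectors of length $n$ other than $(1,\dots,1)$, so that $(0,\dots,0)$ labels the neutral element of $A$ (the labeling is otherwise arbitrary). Then $\mathcal{J}(A)$ is the disjoint union $A\cup B$ with the operation $\circ$ given by $(x_i)\circ(y_i)=(x_i)\cdot(y_i)$; $(x_i)\circ[y_i]=[x_i\oplus y_i]$; $[x_i]\circ(y_i)=[x_i\oplus y_i]$; $[x_i]\circ[y_i]=[x_i']$ if $[x_i]=[y_i]$, and $[x_i]\circ[y_i]=((x_i\oplus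 y_i)')$ otherwise. Here $\oplus$ is coordinatewise addition modulo $2$ and $'$ is the coordinatewise binary complement. When $|A|=2^n-1$, $\mathcal{J}(A)$ is a commutative loop of order $2^{n+1}-1$, so the construction can be iterated. *)

theory Defs
  imports "HOL-Algebra.Elementary_Groups"
begin

locale quasigroup =
  fixes Q (structure)
  assumes m_closed: "\<lbrakk>x \<in> carrier Q; y \<in> carrier Q\<rbrakk> \<Longrightarrow> x \<otimes> y \<in> carrier Q"
    and left_div: "\<lbrakk>a \<in> carrier Q; b \<in> carrier Q\<rbrakk> \<Longrightarrow> \<exists>!x. x \<in> carrier Q \<and> a \<otimes> x = b"
    and right_div: "\<lbrakk>a \<in> carrier Q; b \<in> carrier Q\<rbrakk> \<Longrightarrow> \<exists>!y. y \<in> carrier Q \<and> y \<otimes> a = b"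

locale loop = quasigroup +
  assumes one_closed: "\<one> \<in> carrier Q"
    and l_one: "x \<in> carrier Q \<Longrightarrow> \<one> \<otimes> x = x"
    and r_one: "x \<in> carrier Q \<Longrightarrow> x \<otimes> \<one> = x"

locale jordan_loop = loop +
  assumes m_comm: "\<lbrakk>x \<in> carrier Q; y \<in> carrier Q\<rbrakk> \<Longrightarrow> x \<otimes> y = y \<otimes> x"
    and jordan: "\<lbrakk>x \<in> carrier Q; y \<in> carrier Q\<rbrakk>
      \<Longrightarrow> (x \<otimes> x) \<otimes> (y \<otimes> x) = ((x \<otimes> x) \<otimes> y) \<otimes> x"

definition associative :: "('a, 'b) monoid_scheme \<Rightarrow> bool" where
  "associative Q \<longleftrightarrow> (\<forall>x \<in> carrier Q. \<forall>y \<in> carrier Q. \<forall>z \<in> carrier Q.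
     (x \<otimes>\<^bsub>Q\<^esub> y) \<otimes>\<^bsub>Q\<^esub> z = x \<otimes>\<^bsub>Q\<^esub> (y \<otimes>\<^bsub>Q\<^esub> z))"

definition left_trans :: "('a, 'b) monoid_scheme \<Rightarrow> 'a \<Rightarrow> 'a \<Rightarrow> 'a" where
  "left_trans Q x = (\<lambda>y. x \<otimes>\<^bsub>Q\<^esub> y)"

definition right_trans :: "('a, 'b) monoid_scheme \<Rightarrow> 'a \<Rightarrow> 'a \<Rightarrow> 'a" where
  "right_trans Q x = (\<lambda>y. y \<otimes>\<^bsub>Q\<^esub> x)"

definition inner_L :: "('a, 'b) monoid_scheme \<Rightarrow> 'a \<Rightarrow> 'a \<Rightarrow> 'a \<Rightarrow> 'a" where
  "inner_L Q x y =
     inv_into (carrier Q) (left_trans Q (y \<otimes>\<^bsub>Q\<^esub> x)) \<circ> left_trans Q y \<circ> left_trans Q x"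

definition inner_R :: "('a, 'b) monoid_scheme \<Rightarrow> 'a \<Rightarrow> 'a \<Rightarrow> 'a \<Rightarrow> 'a" where
  "inner_R Q x y =
     inv_into (carrier Q) (right_trans Q (x \<otimes>\<^bsub>Q\<^esub> y)) \<circ> right_trans Q y \<circ> right_trans Q x"

definition inner_T :: "('a, 'b) monoid_scheme \<Rightarrow> 'a \<Rightarrow> 'a \<Rightarrow> 'a" where
  "inner_T Q x = inv_into (carrier Q) (right_trans Q x) \<circ> left_trans Q x"

definition subloop :: "'a set \<Rightarrow> ('a, 'b) monoid_scheme \<Rightarrow> bool" where
  "subloop S Q \<longleftrightarrow> S \<subseteq> carrier Q \<and> loop (Q\<lparr>carrier := S\<rparr>)"

definition normal_subloop :: "'a set \<Rightarrow> ('a, 'b) monoid_scheme \<Rightarrow> bool" where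
  "normal_subloop S Q \<longleftrightarrow> subloop S Q \<and>
     (\<forall>x \<in> carrier Q. \<forall>y \<in> carrier Q.
        inner_L Q x y ` S \<subseteq> S \<and> inner_R Q x y ` S \<subseteq> S \<and> inner_T Q x ` S \<subseteq> S)"

definition simple_loop :: "('a, 'b) monoid_scheme \<Rightarrow> bool" where
  "simple_loop Q \<longleftrightarrow> loop Q \<and>
     (\<forall>S. normal_subloop S Q \<longrightarrow> S = {\<one>\<^bsub>Q\<^esub>} \<or> S = carrier Q)"

definition bvecs :: "nat \<Rightarrow> bool list set" where
  "bvecs n = {x. length x = n}"

definition bvec_add :: "bool list \<Rightarrow> bool list \<Rightarrow> bool list" where
  "bvec_add x y = map2 (\<noteq>) x y"

definition bvec_compl :: "bool list \<Rightarrow> bool list" where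
  "bvec_compl x = map Not x"

text \<open>The functions \<open>lab\<close> and \<open>br\<close> send a 0-1 vector \<open>x\<close> to the elements written
  \<open>(x)\<close> of \<open>A\<close> and \<open>[x]\<close> of \<open>B\<close>, respectively.\<close>

definition admissible_labeling ::
    "nat \<Rightarrow> ('a, 'b) monoid_scheme \<Rightarrow> (bool list \<Rightarrow> 'a) \<Rightarrow> bool" where
  "admissible_labeling n A lab \<longleftrightarrow>
     n \<ge> 1 \<and>
     bij_betw lab (bvecs n - {replicate n True}) (carrier A) \<and>
     lab (replicate n False) = \<one>\<^bsub>A\<^esub>"

text \<open>\<open>is_J n lab br A C\<close> says that \<open>C\<close> is the loop \<open>J(A)\<close> formed with the labeling \<open>lab\<close>
  of \<open>A\<close> and with \<open>B = br ` bvecs n\<close>. It is a relation, and \<open>B\<close> is an arbitrary set disjoint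
  from \<open>A\<close> inside the same type, so that the construction can be iterated without changing
  the type of elements.\<close>

definition is_J :: "nat \<Rightarrow> (bool list \<Rightarrow> 'a) \<Rightarrow> (bool list \<Rightarrow> 'a)
    \<Rightarrow> 'a monoid \<Rightarrow> 'a monoid \<Rightarrow> bool" where
  "is_J n lab br A C \<longleftrightarrow>
     admissible_labeling n A lab \<and>
     inj_on br (bvecs n) \<and> carrier A \<inter> br ` bvecs n = {} \<and>
     carrier C = carrier A \<union> br ` bvecs n \<and>
     \<one>\<^bsub>C\<^esub> = \<one>\<^bsub>A\<^esub> \<and>
     (\<forall>x \<in> bvecs n - {replicate n True}. \<forall>y \<in> bvecs n - {replicate n True}.
        lab x \<otimes>\<^bsub>C\<^esub> lab y = lab x \<otimes>\<^bsub>A\<^esub> lab y) \<and>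
     (\<forall>x \<in> bvecs n - {replicate n True}. \<forall>y \<in> bvecs n.
        lab x \<otimes>\<^bsub>C\<^esub> br y = br (bvec_add x y)) \<and>
     (\<forall>x \<in> bvecs n. \<forall>y \<in> bvecs n - {replicate n True}.
        br x \<otimes>\<^bsub>C\<^esub> lab y = br (bvec_add x y)) \<and>
     (\<forall>x \<in> bvecs n. \<forall>y \<in> bvecs n.
        br x \<otimes>\<^bsub>C\<^esub> br y =
          (if x = y then br (bvec_compl x) else lab (bvec_compl (bvec_add x y))))"

end

theory Submission
  imports Defs
begin

text \<open>
  Squares in \<open>B\<close> land in \<open>B\<close> while all other products of two elements of \<open>B\<close> land in \<open>A\<close>.
  The Jordan identity for \<open>\<J>(A)\<close> reduces, outside \<open>A\<close>, to identities between 0-1 vectors.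
  For simplicity, a normal subloop \<open>S\<close> contains with \<open>s\<close> the solution \<open>t\<close> of
  \<open>(y \<circ> x) \<circ> t = y \<circ> (x \<circ> s)\<close>. If \<open>1 \<noteq> s = (v) \<in> S \<inter> A\<close>, then \<open>x = [a]\<close>,
  \<open>y = [a \<oplus> v]\<close> makes \<open>y\<close> and \<open>x \<circ> s\<close> coincide and forces \<open>t \<in> B\<close>.
  If \<open>s = [v] \<in> S\<close>, then \<open>x = y = [v \<oplus> c]\<close> gives \<open>t = (c)\<close> for every \<open>c\<close>
  different from \<open>0\<close> and its complement, so \<open>A\<close>, and therefore all of \<open>\<J>(A)\<close>, lies in \<open>S\<close>.
  The latter choice also violates associativity as soon as such a \<open>c\<close> exists, that is, for \<open>n \<ge> 2\<close>.
\<close>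

section \<open>Arithmetic of 0-1 vectors\<close>

lemma bvec_add_closed [simp]: "\<lbrakk>x \<in> bvecs n; y \<in> bvecs n\<rbrakk> \<Longrightarrow> bvec_add x y \<in> bvecs n"
  by (simp add: bvecs_def bvec_add_def)

lemma bvec_compl_closed [simp]: "x \<in> bvecs n \<Longrightarrow> bvec_compl x \<in> bvecs n"
  by (simp add: bvecs_def bvec_compl_def)

lemma replicate_in_bvecs [simp]: "replicate n b \<in> bvecs n"
  by (simp add: bvecs_def)

lemma nth_bvec_add:
  "\<lbrakk>x \<in> bvecs n; y \<in> bvecs n; i < n\<rbrakk> \<Longrightarrow> bvec_add x y ! i = (x ! i \<noteq> y ! i)"
  by (simp add: bvecs_def bvec_add_def)

lemma nth_bvec_compl: "\<lbrakk>x \<in> bvecs n; i < n\<rbrakk> \<Longrightarrow> bvec_compl x ! i = (\<not> x ! i)"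
  by (simp add: bvecs_def bvec_compl_def)

text \<open>Turns identities between vectors into propositional identities at each coordinate, which
  automation settles.\<close>

lemma bvec_eq_iff: "\<lbrakk>x \<in> bvecs n; y \<in> bvecs n\<rbrakk> \<Longrightarrow> x = y \<longleftrightarrow> (\<forall>i<n. x ! i = y ! i)"
  by (auto simp: bvecs_def list_eq_iff_nth_eq)

lemma bvec_add_commute: "\<lbrakk>x \<in> bvecs n; y \<in> bvecs n\<rbrakk> \<Longrightarrow> bvec_add x y = bvec_add y x"
  by (auto simp: bvec_eq_iff[of _ n] nth_bvec_add[of _ n])

section \<open>Inner mappings and subloops\<close>

lemma (in loop) inner_L_witness:
  assumes "normal_subloop S Q" "s \<in> S" "x \<in> carrier Q" "y \<in> carrier Q"
  obtains t where "t \<in> S" "(y \<otimes> x) \<otimes> t = y \<otimes> (x \<otimes> s)"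
proof
  have s: "s \<in> carrier Q"
    using assms unfolding normal_subloop_def subloop_def by blast
  show "inner_L Q x y s \<in> S"
    using assms unfolding normal_subloop_def by blast
  have "y \<otimes> x \<in> carrier Q" "y \<otimes> (x \<otimes> s) \<in> carrier Q"
    using s assms by (simp_all add: m_closed)
  then obtain t where "t \<in> carrier Q" "(y \<otimes> x) \<otimes> t = y \<otimes> (x \<otimes> s)"
    using left_div by blast
  \<comment> \<open>\<open>inv_into\<close> is unspecified outside the image, so membership in the
    image comes first.\<close>
  then have "y \<otimes> (x \<otimes> s) \<in> left_trans Q (y \<otimes> x) ` carrier Q"
    by (metis imageI left_trans_def)
  from f_inv_into_f[OF this] show "(y \<otimes> x) \<otimes> inner_L Q x y s = y \<otimes> (x \<otimes> s)"
    by (simp add: inner_L_def left_trans_def)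
qed

lemma subloopD:
  assumes "subloop S Q"
  shows "\<one>\<^bsub>Q\<^esub> \<in> S" "\<lbrakk>x \<in> S; y \<in> S\<rbrakk> \<Longrightarrow> x \<otimes>\<^bsub>Q\<^esub> y \<in> S"
  using assms loop.one_closed[of "Q\<lparr>carrier := S\<rparr>"]
    quasigroup.m_closed[of "Q\<lparr>carrier := S\<rparr>" x y] loop.axioms(1)[of "Q\<lparr>carrier := S\<rparr>"]
  by (auto simp: subloop_def)

lemma loop_commI:
  fixes Q (structure)
  assumes "\<And>x y. \<lbrakk>x \<in> carrier Q; y \<in> carrier Q\<rbrakk> \<Longrightarrow> x \<otimes> y \<in> carrier Q"
    and comm: "\<And>x y. \<lbrakk>x \<in> carrier Q; y \<in> carrier Q\<rbrakk> \<Longrightarrow> x \<otimes> y = y \<otimes> x"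
    and div: "\<And>a b. \<lbrakk>a \<in> carrier Q; b \<in> carrier Q\<rbrakk> \<Longrightarrow> \<exists>!x. x \<in> carrier Q \<and> a \<otimes> x = b"
    and "\<one> \<in> carrier Q" "\<And>x. x \<in> carrier Q \<Longrightarrow> \<one> \<otimes> x = x"
  shows "loop Q"
proof
  fix a b assume ab: "a \<in> carrier Q" "b \<in> carrier Q"
  have "(y \<in> carrier Q \<and> y \<otimes> a = b) = (y \<in> carrier Q \<and> a \<otimes> y = b)" for y
    using comm ab by auto
  then show "\<exists>!y. y \<in> carrier Q \<and> y \<otimes> a = b" using div[OF ab] by simp
qed (use assms in auto)

section \<open>One step of the construction: elements and products of J(A)\<close>

locale J_extension = A: jordan_loop A for A :: "'a monoid" +
  fixes n :: nat and lab br :: "bool list \<Rightarrow> 'a" and C :: "'a monoid"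
  assumes is_J: "is_J n lab br A C"
begin

abbreviation labels :: "bool list set" where
  "labels \<equiv> bvecs n - {replicate n True}"

text \<open>The left-hand sides do not mention the length, so \<open>n\<close> is instantiated
  before rewriting.\<close>

lemmas bvec_simps = bvec_eq_iff[of _ n] nth_bvec_add[of _ n] nth_bvec_compl[of _ n]

lemma
  shows n_pos: "n \<ge> 1"
    and lab_bij: "bij_betw lab labels (carrier A)"
    and lab_zero: "lab (replicate n False) = \<one>\<^bsub>A\<^esub>"
    and br_inj: "inj_on br (bvecs n)"
    and br_disjoint: "carrier A \<inter> br ` bvecs n = {}"
    and carrier_eq: "carrier C = carrier A \<union> br ` bvecs n"
    and one_eq: "\<one>\<^bsub>C\<^esub> = \<one>\<^bsub>A\<^esub>"
    and mult_lab_lab: "\<lbrakk>x \<in> labels; y \<in> labels\<rbrakk> \<Longrightarrow> lab x \<otimes>\<^bsub>C\<^esub> lab y = lab x \<otimes>\<^bsub>A\<^esub> lab y"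
    and mult_lab_br: "\<lbrakk>x \<in> labels; y \<in> bvecs n\<rbrakk> \<Longrightarrow> lab x \<otimes>\<^bsub>C\<^esub> br y = br (bvec_add x y)"
    and mult_br_lab: "\<lbrakk>x \<in> bvecs n; y \<in> labels\<rbrakk> \<Longrightarrow> br x \<otimes>\<^bsub>C\<^esub> lab y = br (bvec_add x y)"
    and mult_br_br: "\<lbrakk>x \<in> bvecs n; y \<in> bvecs n\<rbrakk> \<Longrightarrow> br x \<otimes>\<^bsub>C\<^esub> br y =
          (if x = y then br (bvec_compl x) else lab (bvec_compl (bvec_add x y)))"
  using is_J unfolding is_J_def admissible_labeling_def by blast+

lemma lab_closed [simp]: "x \<in> labels \<Longrightarrow> lab x \<in> carrier A"
  using lab_bij by (auto simp: bij_betw_def)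

lemma br_eq_iff: "\<lbrakk>x \<in> bvecs n; y \<in> bvecs n\<rbrakk> \<Longrightarrow> br x = br y \<longleftrightarrow> x = y"
  using br_inj by (auto simp: inj_on_def)

lemma lab_eq_iff: "\<lbrakk>x \<in> labels; y \<in> labels\<rbrakk> \<Longrightarrow> lab x = lab y \<longleftrightarrow> x = y"
  using lab_bij by (auto simp: bij_betw_def inj_on_def)

lemma br_not_in_A [simp]: "x \<in> bvecs n \<Longrightarrow> br x \<notin> carrier A"
  using br_disjoint by blast

lemma A_cases:
  assumes "c \<in> carrier A"
  obtains x where "x \<in> labels" "c = lab x"
  using assms lab_bij by (auto simp: bij_betw_def)

lemma C_cases:
  assumes "c \<in> carrier C"
  obtains (lab) x where "x \<in> labels" "c = lab x" | (br) x where "x \<in> bvecs n" "c = br x"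
  using assms carrier_eq A_cases by blast

lemma mult_A: "\<lbrakk>a \<in> carrier A; b \<in> carrier A\<rbrakk> \<Longrightarrow> a \<otimes>\<^bsub>C\<^esub> b = a \<otimes>\<^bsub>A\<^esub> b"
  by (metis A_cases mult_lab_lab)

lemma zero_in_labels: "replicate n False \<in> labels"
  \<comment> \<open>As \<open>n\<close> is positive, coordinate 0 exists and separates the zero
    vector from the all-ones vector.\<close>
  using n_pos by (auto simp: bvec_simps intro: exI[of _ 0])

text \<open>The complement of the sum is the all-ones vector, which labels nothing, only if the sum
  is 0. This is why squares in B need their own rule.\<close>

lemma compl_add_in_labels:
  assumes "x \<in> bvecs n" "y \<in> bvecs n" "x \<noteq> y"
  shows "bvec_compl (bvec_add x y) \<in> labels"
  using assms by (auto simp: bvec_simps)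

section \<open>J(A) is a commutative loop\<close>

lemma C_m_closed:
  assumes "x \<in> carrier C" "y \<in> carrier C"
  shows "x \<otimes>\<^bsub>C\<^esub> y \<in> carrier C"
  using assms
  by (elim C_cases)
    (auto simp: carrier_eq mult_A A.m_closed mult_lab_br mult_br_lab mult_br_br
      lab_closed[OF compl_add_in_labels])

lemma C_m_comm:
  assumes "x \<in> carrier C" "y \<in> carrier C"
  shows "x \<otimes>\<^bsub>C\<^esub> y = y \<otimes>\<^bsub>C\<^esub> x"
  using assms
  by (elim C_cases)
    (auto simp: mult_A mult_lab_br mult_br_lab mult_br_br A.m_comm bvec_add_commute[of _ n])

text \<open>Multiplication by an element of A preserves A and B. From [u], the elements of A are
  reached through B, and [v] is reached through the label of u \<oplus> v. The one gap is v = u',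
  where u \<oplus> v is all ones; the square of [u] fills it.\<close>

lemma C_left_div:
  assumes a: "a \<in> carrier C" and b: "b \<in> carrier C"
  shows "\<exists>!x. x \<in> carrier C \<and> a \<otimes>\<^bsub>C\<^esub> x = b"
  using a
proof (cases rule: C_cases)
  case (lab u)
  note u = lab
  show ?thesis
    using b
  proof (cases rule: C_cases)
    case (lab v)
    have ab: "a \<in> carrier A" "b \<in> carrier A" using u lab by auto
    have "(x \<in> carrier C \<and> a \<otimes>\<^bsub>C\<^esub> x = b) = (x \<in> carrier A \<and> a \<otimes>\<^bsub>A\<^esub> x = b)" for x
    proof (cases "x \<in> carrier A")
      case True
      then show ?thesis using ab by (simp add: mult_A carrier_eq)
    next
      case False
      have "a \<otimes>\<^bsub>C\<^esub> x \<noteq> b" if "x \<in> carrier C"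
        using that False u ab by (cases rule: C_cases) (auto simp: mult_lab_br)
      then show ?thesis using False by blast
    qed
    then show ?thesis using A.left_div[OF ab] by simp
  next
    case (br v)
    show ?thesis
    proof (rule ex1I[of _ "br (bvec_add u v)"])
      show "br (bvec_add u v) \<in> carrier C \<and> a \<otimes>\<^bsub>C\<^esub> br (bvec_add u v) = b"
        using u br by (auto simp: carrier_eq mult_lab_br br_eq_iff bvec_simps)
      fix x assume x: "x \<in> carrier C \<and> a \<otimes>\<^bsub>C\<^esub> x = b"
      then have "x \<in> carrier C" ..
      then show "x = br (bvec_add u v)"
      proof (cases rule: C_cases)
        case (lab w)
        then have "b \<in> carrier A" using x u by (auto simp: mult_A A.m_closed)
        then show ?thesis using br by simp
      next
        case (br w)
        then show ?thesis using x u \<open>b = br v\<close> \<open>v \<in> bvecs n\<close>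
          by (auto simp: mult_lab_br br_eq_iff bvec_simps)
      qed
    qed
  qed
next
  case (br u)
  note u = br
  show ?thesis
    using b
  proof (cases rule: C_cases)
    case (lab v)
    \<comment> \<open>The solution w of (u \<oplus> w)' = v. It differs from u because v is not all
      ones, so the product is not a square.\<close>
    let ?w = "bvec_compl (bvec_add u v)"
    have w: "?w \<in> bvecs n" "?w \<noteq> u" "bvec_compl (bvec_add u ?w) = v"
      using u lab by (auto simp: bvec_simps)
    show ?thesis
    proof (rule ex1I[of _ "br ?w"])
      show "br ?w \<in> carrier C \<and> a \<otimes>\<^bsub>C\<^esub> br ?w = b"
        using u lab w by (auto simp: carrier_eq mult_br_br)
      fix x assume x: "x \<in> carrier C \<and> a \<otimes>\<^bsub>C\<^esub> x = b"
      then have "x \<in> carrier C" ..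
      then show "x = br ?w"
      proof (cases rule: C_cases)
        case (lab w)
        then have "b = br (bvec_add u w)" using x u by (auto simp: mult_br_lab)
        then have "b \<notin> carrier A" using u lab by simp
        then show ?thesis using \<open>b = lab v\<close> \<open>v \<in> labels\<close> by simp
      next
        case (br y)
        have "u \<noteq> y"
          using x u br \<open>b = lab v\<close> \<open>v \<in> labels\<close>
          by (metis br_not_in_A bvec_compl_closed lab_closed mult_br_br)
        then have "lab (bvec_compl (bvec_add u y)) = lab v"
          using x u br \<open>b = lab v\<close> by (auto simp: mult_br_br)
        then have "bvec_compl (bvec_add u y) = v"
          using lab_eq_iff compl_add_in_labels u br \<open>u \<noteq> y\<close> \<open>v \<in> labels\<close> by blast
        then have "y = ?w"
          using u br by (auto simp: bvec_simps)
        then show ?thesis using br by simp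
      qed
    qed
  next
    case (br v)
    note v = br
    show ?thesis
    proof (cases "v = bvec_compl u")
      case True
      show ?thesis
      proof (rule ex1I[of _ "br u"])
        show "br u \<in> carrier C \<and> a \<otimes>\<^bsub>C\<^esub> br u = b"
          using u v True by (auto simp: carrier_eq mult_br_br)
        fix x assume x: "x \<in> carrier C \<and> a \<otimes>\<^bsub>C\<^esub> x = b"
        then have "x \<in> carrier C" ..
        then show "x = br u"
        proof (cases rule: C_cases)
          case (lab w)
          then have "bvec_add u w = bvec_compl u"
            using x u v True by (auto simp: mult_br_lab br_eq_iff)
          \<comment> \<open>A contradiction, since the all-ones vector is not a label.\<close>
          then have "w = replicate n True"
            using lab u by (auto simp: bvec_simps)
          then show ?thesis using lab by simp
        next
          case (br w)
          then show ?thesis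
            using x u v by (metis br_not_in_A compl_add_in_labels lab_closed mult_br_br)
        qed
      qed
    next
      case False
      let ?w = "bvec_add u v"
      have w: "?w \<in> labels" "bvec_add u ?w = v"
        using u v False by (auto simp: bvec_simps)
      show ?thesis
      proof (rule ex1I[of _ "lab ?w"])
        show "lab ?w \<in> carrier C \<and> a \<otimes>\<^bsub>C\<^esub> lab ?w = b"
          using u v w by (auto simp: carrier_eq mult_br_lab)
        fix x assume x: "x \<in> carrier C \<and> a \<otimes>\<^bsub>C\<^esub> x = b"
        then have "x \<in> carrier C" ..
        then show "x = lab ?w"
        proof (cases rule: C_cases)
          case (lab y)
          then have "bvec_add u y = v"
            using x u v by (auto simp: mult_br_lab br_eq_iff)
          then have "y = ?w"
            using lab u by (auto simp: bvec_simps)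
          then show ?thesis using lab by simp
        next
          case (br y)
          then show ?thesis
            using x u v False
            by (metis br_not_in_A br_eq_iff bvec_compl_closed compl_add_in_labels lab_closed mult_br_br)
        qed
      qed
    qed
  qed
qed

sublocale C: loop C
proof (rule loop_commI)
  show "\<one>\<^bsub>C\<^esub> \<in> carrier C" by (simp add: one_eq carrier_eq A.one_closed)
  fix x assume "x \<in> carrier C"
  then show "\<one>\<^bsub>C\<^esub> \<otimes>\<^bsub>C\<^esub> x = x"
  proof (cases rule: C_cases)
    case (lab u)
    then show ?thesis by (simp add: one_eq mult_A A.one_closed A.l_one)
  next
    case (br u)
    then have "lab (replicate n False) \<otimes>\<^bsub>C\<^esub> x = x"
      using zero_in_labels by (auto simp: mult_lab_br br_eq_iff bvec_simps)
    then show ?thesis by (simp add: one_eq lab_zero)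
  qed
qed (fact C_m_closed C_m_comm C_left_div)+

section \<open>The Jordan identity in J(A)\<close>

lemma mult_br_br_eq: "x \<in> bvecs n \<Longrightarrow> br x \<otimes>\<^bsub>C\<^esub> br x = br (bvec_compl x)"
  by (simp add: mult_br_br)

lemma mult_br_br_neq:
  "\<lbrakk>x \<in> bvecs n; y \<in> bvecs n; x \<noteq> y\<rbrakk>
    \<Longrightarrow> br x \<otimes>\<^bsub>C\<^esub> br y = lab (bvec_compl (bvec_add x y))"
  by (simp add: mult_br_br)

text \<open>The sum of x and x' is all ones, and its complement 0 labels the neutral element. Thus
  [x'] is both the square and the inverse of [x].\<close>

lemma mult_br_compl:
  assumes "x \<in> bvecs n"
  shows "br x \<otimes>\<^bsub>C\<^esub> br (bvec_compl x) = \<one>\<^bsub>C\<^esub>"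
proof -
  have "x \<noteq> bvec_compl x" "bvec_compl (bvec_add x (bvec_compl x)) = replicate n False"
    using assms n_pos by (auto simp: bvec_simps intro: exI[of _ 0])
  then show ?thesis using assms by (simp add: mult_br_br one_eq lab_zero)
qed

text \<open>These are the two sides of the Jordan identity for x = [u] and y = (w). Neither product
  is a square, because w is not all ones.\<close>

lemma mult_lab_br_square:
  assumes "u \<in> bvecs n" "w \<in> labels"
  shows "br (bvec_compl u) \<otimes>\<^bsub>C\<^esub> br (bvec_add w u) = lab w"
    "br (bvec_add (bvec_compl u) w) \<otimes>\<^bsub>C\<^esub> br u = lab w"
proof -
  have "bvec_compl u \<noteq> bvec_add w u" "bvec_add (bvec_compl u) w \<noteq> u"
    "bvec_compl (bvec_add (bvec_compl u) (bvec_add w u)) = w"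
    "bvec_compl (bvec_add (bvec_add (bvec_compl u) w) u) = w"
    using assms by (auto simp: bvec_simps)
  then show "br (bvec_compl u) \<otimes>\<^bsub>C\<^esub> br (bvec_add w u) = lab w"
    "br (bvec_add (bvec_compl u) w) \<otimes>\<^bsub>C\<^esub> br u = lab w"
    using assms by (simp_all add: mult_br_br_neq)
qed

text \<open>For x in A the identity is inherited from A or is associativity of \<oplus>. For x in B
  and y in A it is \<open>mult_lab_br_square\<close>. For x and y in B both sides equal y.\<close>

lemma C_jordan:
  assumes x: "x \<in> carrier C" and y: "y \<in> carrier C"
  shows "(x \<otimes>\<^bsub>C\<^esub> x) \<otimes>\<^bsub>C\<^esub> (y \<otimes>\<^bsub>C\<^esub> x) = ((x \<otimes>\<^bsub>C\<^esub> x) \<otimes>\<^bsub>C\<^esub> y) \<otimes>\<^bsub>C\<^esub> x"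
  using x
proof (cases rule: C_cases)
  case (lab u)
  note u = lab
  show ?thesis
    using y
  proof (cases rule: C_cases)
    case (lab v)
    then show ?thesis using u by (simp add: mult_A A.m_closed A.jordan)
  next
    case (br v)
    \<comment> \<open>The product of A is unrelated to \<oplus>, so the square of x just receives
      some label.\<close>
    obtain w where w: "w \<in> labels" "x \<otimes>\<^bsub>C\<^esub> x = lab w"
      using A_cases A.m_closed u by (metis mult_A lab_closed)
    have "bvec_add w (bvec_add v u) = bvec_add (bvec_add w v) u"
      using u br w by (auto simp: bvec_simps)
    then show ?thesis unfolding w using u br w(1)
      by (simp add: mult_br_lab mult_lab_br)
  qed
next
  case (br u)
  note u = br
  have sq: "x \<otimes>\<^bsub>C\<^esub> x = br (bvec_compl u)" using u by (simp add: mult_br_br)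
  show ?thesis
    using y
  proof (cases rule: C_cases)
    case (lab v)
    then show ?thesis unfolding sq using u
      by (simp add: mult_lab_br mult_br_lab mult_lab_br_square)
  next
    case (br v)
    have cc: "bvec_compl (bvec_compl u) = u" using u by (auto simp: bvec_simps)
    have comm1: "br (bvec_compl u) \<otimes>\<^bsub>C\<^esub> br u = \<one>\<^bsub>C\<^esub>"
      using mult_br_compl[of "bvec_compl u"] u cc by simp
    \<comment> \<open>If v = u, then y \<circ> x is a square; if v = u', then the product of y with
      the square of x is one. Otherwise both lie in A.\<close>
    consider "v = u" | "v = bvec_compl u" | "v \<noteq> u" "v \<noteq> bvec_compl u" by blast
    then show ?thesis
    proof cases
      case 1
      then show ?thesis unfolding sq using u br x comm1 C.l_one[OF x]
        by (simp add: mult_br_br_eq cc)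
    next
      case 2
      have "br (bvec_compl u) \<otimes>\<^bsub>C\<^esub> \<one>\<^bsub>C\<^esub> = br (bvec_compl u)"
        using C.r_one u by (simp add: carrier_eq)
      with 2 show ?thesis unfolding sq using u br comm1
        by (simp add: mult_br_br_eq cc)
    next
      case 3
      have eqs: "bvec_add (bvec_compl u) (bvec_compl (bvec_add v u)) = v"
        "bvec_add (bvec_compl (bvec_add (bvec_compl u) v)) u = v"
        using u br by (auto simp: bvec_simps)
      show ?thesis unfolding sq
        using u br 3 eqs compl_add_in_labels[of v u] compl_add_in_labels[of "bvec_compl u" v]
        by (simp add: mult_br_br_neq mult_br_lab mult_lab_br del: Diff_iff)
    qed
  qed
qed

lemma jordan_loop_C: "jordan_loop C"
  by unfold_locales (fact C_m_comm C_jordan)+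

section \<open>Simplicity and nonassociativity of J(A)\<close>

text \<open>The first two equations identify (c) as the image of [v] under an inner mapping; the
  first and third give a failure of associativity. Here c \<noteq> 0 yields a \<noteq> v, and c not
  being all ones yields a' \<noteq> v.\<close>

lemma br_square_associator:
  assumes "v \<in> bvecs n" "c \<in> labels" "c \<noteq> replicate n False"
  defines "a \<equiv> bvec_add v c"
  shows "br a \<otimes>\<^bsub>C\<^esub> (br a \<otimes>\<^bsub>C\<^esub> br v) = br (bvec_compl v)"
    and "(br a \<otimes>\<^bsub>C\<^esub> br a) \<otimes>\<^bsub>C\<^esub> lab c = br (bvec_compl v)"
    and "(br a \<otimes>\<^bsub>C\<^esub> br a) \<otimes>\<^bsub>C\<^esub> br v = lab c"
proof -
  have a: "a \<in> bvecs n" "a \<noteq> v" "bvec_compl a \<noteq> v"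
    "bvec_add a (bvec_compl (bvec_add a v)) = bvec_compl v"
    "bvec_add (bvec_compl a) c = bvec_compl v"
    "bvec_compl (bvec_add (bvec_compl a) v) = c"
    using assms by (auto simp: bvec_simps)
  show "br a \<otimes>\<^bsub>C\<^esub> (br a \<otimes>\<^bsub>C\<^esub> br v) = br (bvec_compl v)"
    "(br a \<otimes>\<^bsub>C\<^esub> br a) \<otimes>\<^bsub>C\<^esub> lab c = br (bvec_compl v)"
    "(br a \<otimes>\<^bsub>C\<^esub> br a) \<otimes>\<^bsub>C\<^esub> br v = lab c"
    using assms(1,2) a compl_add_in_labels[of a v]
    by (simp_all add: mult_br_br_eq mult_br_br_neq mult_br_lab del: Diff_iff)
qed

text \<open>Inner mappings carry [v] to every (c) with c \<noteq> 0, so A lies in S; products with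
  [v] then give B.\<close>

lemma normal_subloop_C_with_br:
  assumes S: "normal_subloop S C" and v: "v \<in> bvecs n" "br v \<in> S"
  shows "S = carrier C"
proof
  have sub: "subloop S C" using S by (simp add: normal_subloop_def)
  then show "S \<subseteq> carrier C" by (simp add: subloop_def)
  have lab: "lab c \<in> S" if c: "c \<in> labels" for c
  proof (cases "c = replicate n False")
    case True
    then show ?thesis using subloopD(1)[OF sub] by (simp add: lab_zero one_eq)
  next
    case False
    let ?a = "bvec_add v c"
    have a: "br ?a \<in> carrier C" using v c by (simp add: carrier_eq)
    obtain t where t: "t \<in> S" "(br ?a \<otimes>\<^bsub>C\<^esub> br ?a) \<otimes>\<^bsub>C\<^esub> t = br ?a \<otimes>\<^bsub>C\<^esub> (br ?a \<otimes>\<^bsub>C\<^esub> br v)"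
      using C.inner_L_witness[OF S v(2) a a] .
    then have "(br ?a \<otimes>\<^bsub>C\<^esub> br ?a) \<otimes>\<^bsub>C\<^esub> t = (br ?a \<otimes>\<^bsub>C\<^esub> br ?a) \<otimes>\<^bsub>C\<^esub> lab c"
      using br_square_associator[OF v(1) c False] by simp
    moreover have "t \<in> carrier C" "lab c \<in> carrier C" "br ?a \<otimes>\<^bsub>C\<^esub> br ?a \<in> carrier C"
      using t \<open>S \<subseteq> carrier C\<close> c a C_m_closed by (auto simp: carrier_eq)
    ultimately have "t = lab c"
      using C_left_div C_m_closed by blast
    then show ?thesis using t by simp
  qed
  show "carrier C \<subseteq> S"
  proof
    fix x assume "x \<in> carrier C"
    then show "x \<in> S"
    proof (cases rule: C_cases)
      case (lab c)
      then show ?thesis using \<open>\<And>c. c \<in> labels \<Longrightarrow> lab c \<in> S\<close> by blast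
    next
      case (br w)
      show ?thesis
      \<comment> \<open>Here v \<oplus> w would be all ones, so [w] is obtained as the square of [v]
        instead.\<close>
      proof (cases "w = bvec_compl v")
        case True
        then show ?thesis using subloopD(2)[OF sub v(2) v(2)] br v by (simp add: mult_br_br_eq)
      next
        case False
        have "bvec_add v w \<in> labels" "bvec_add v (bvec_add v w) = w"
          using False v br by (auto simp: bvec_simps)
        then show ?thesis
          using subloopD(2)[OF sub v(2) lab] v br by (metis mult_br_lab)
      qed
    qed
  qed
qed

lemma simple_loop_C: "simple_loop C"
  unfolding simple_loop_def
proof (intro conjI allI impI)
  show "loop C" ..
  fix S assume S: "normal_subloop S C"
  then have sub: "subloop S C" by (simp add: normal_subloop_def)
  show "S = {\<one>\<^bsub>C\<^esub>} \<or> S = carrier C"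
  proof (cases "S = {\<one>\<^bsub>C\<^esub>}")
    case False
    then obtain s where s: "s \<in> S" "s \<noteq> \<one>\<^bsub>C\<^esub>"
      using subloopD(1)[OF sub] by blast
    have SC: "S \<subseteq> carrier C" using sub by (simp add: subloop_def)
    have "\<exists>v\<in>bvecs n. br v \<in> S"
      using subsetD[OF SC s(1)]
    proof (cases rule: C_cases)
      case (br v)
      then show ?thesis using s by blast
    next
      case (lab v)
      \<comment> \<open>With x = [0] and y = [v], the product x \<circ> s is y itself. So y \<circ>
        (x \<circ> s) is a square and lies in B, while y \<circ> x = (v') lies in A; hence t cannot
        lie in A.\<close>
      let ?a = "replicate n False"
      have v: "v \<noteq> ?a" using lab s by (auto simp: lab_zero one_eq)
      have eqs: "v \<noteq> ?a" "bvec_add ?a v = v" "bvec_add v ?a = v"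
        using lab v by (auto simp: bvec_simps)
      have c: "bvec_compl v \<in> labels"
        using lab v by (auto simp: bvec_simps)
      have C: "br ?a \<in> carrier C" "br v \<in> carrier C" using lab by (auto simp: carrier_eq)
      obtain t where t: "t \<in> S" "(br v \<otimes>\<^bsub>C\<^esub> br ?a) \<otimes>\<^bsub>C\<^esub> t = br v \<otimes>\<^bsub>C\<^esub> (br ?a \<otimes>\<^bsub>C\<^esub> s)"
        using C.inner_L_witness[OF S s(1) C] .
      then have eq: "lab (bvec_compl v) \<otimes>\<^bsub>C\<^esub> t = br (bvec_compl v)"
        using lab eqs by (simp add: mult_br_lab mult_br_br)
      show ?thesis
        using subsetD[OF SC t(1)]
      proof (cases rule: C_cases)
        case (br w)
        then show ?thesis using t by blast
      next
        case lab': (lab w)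
        then have "br (bvec_compl v) \<in> carrier A"
          using eq c by (metis A.m_closed lab_closed mult_lab_lab)
        then show ?thesis using lab by simp
      qed
    qed
    then show ?thesis using normal_subloop_C_with_br S by blast
  qed simp
qed

text \<open>A nontrivial A supplies a label c \<noteq> 0, for which associativity would equate an
  element of A with one of B.\<close>

lemma nonassociative_C:
  assumes "carrier A \<noteq> {\<one>\<^bsub>A\<^esub>}"
  shows "\<not> associative C"
proof
  assume assoc: "associative C"
  obtain b where b: "b \<in> carrier A" "b \<noteq> \<one>\<^bsub>A\<^esub>"
    using assms A.one_closed by blast
  then obtain c where c: "c \<in> labels" "b = lab c" by (elim A_cases)
  have c0: "c \<noteq> replicate n False" using b c lab_zero by auto
  let ?v = "replicate n False"
  let ?a = "bvec_add ?v c"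
  have "br ?a \<in> carrier C" "br ?v \<in> carrier C" using c by (simp_all add: carrier_eq)
  then have "(br ?a \<otimes>\<^bsub>C\<^esub> br ?a) \<otimes>\<^bsub>C\<^esub> br ?v = br ?a \<otimes>\<^bsub>C\<^esub> (br ?a \<otimes>\<^bsub>C\<^esub> br ?v)"
    using assoc unfolding associative_def by blast
  then have "lab c = br (bvec_compl ?v)"
    using br_square_associator[OF _ c(1) c0, of ?v] by simp
  then show False using c by (metis br_not_in_A bvec_compl_closed lab_closed replicate_in_bvecs)
qed

text \<open>B is nonempty and misses the neutral element. This makes \<open>nonassociative_C\<close>
  applicable at the next step.\<close>

lemma carrier_C_nontrivial: "carrier C \<noteq> {\<one>\<^bsub>C\<^esub>}"
proof
  assume "carrier C = {\<one>\<^bsub>C\<^esub>}"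
  then have "br (replicate n False) = \<one>\<^bsub>A\<^esub>" by (auto simp: carrier_eq one_eq)
  then show False using A.one_closed br_not_in_A replicate_in_bvecs by metis
qed

end

section \<open>The trivial group and the iteration\<close>

lemma jordan_loop_trivial:
  assumes "trivial_group G"
  shows "jordan_loop G"
proof -
  interpret group G using assms by (simp add: trivial_group_def)
  have c: "carrier G = {\<one>\<^bsub>G\<^esub>}" using assms by (simp add: trivial_group_def)
  show ?thesis by unfold_locales (auto simp: c)
qed

lemma simple_loop_trivial:
  assumes "trivial_group G"
  shows "simple_loop G"
  unfolding simple_loop_def
proof (intro conjI allI impI)
  show "loop G" using jordan_loop.axioms(1)[OF jordan_loop_trivial[OF assms]] .
  fix S assume "normal_subloop S G"
  then have "subloop S G" by (simp add: normal_subloop_def)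
  then have "\<one>\<^bsub>G\<^esub> \<in> S" "S \<subseteq> carrier G"
    by (auto simp: subloopD subloop_def)
  then show "S = {\<one>\<^bsub>G\<^esub>} \<or> S = carrier G"
    using assms by (auto simp: trivial_group_def)
qed

theorem mainTheorem3:
  fixes A :: "nat \<Rightarrow> 'a monoid"
    and n :: "nat \<Rightarrow> nat"
    and lab br :: "nat \<Rightarrow> bool list \<Rightarrow> 'a"
  assumes "trivial_group (A 0)"
    and "\<And>i. is_J (n i) (lab i) (br i) (A i) (A (Suc i))"
  shows "(\<forall>i. jordan_loop (A i)) \<and> (\<forall>i. simple_loop (A i)) \<and> (\<forall>i\<ge>2. \<not> associative (A i))"
proof -
  \<comment> \<open>Only the Jordan property needs induction: it makes \<open>J_extension\<close>
    available at every step, and the rest follows from a single step or two.\<close>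
  have jordan: "jordan_loop (A i)" for i
  proof (induction i)
    case 0
    show ?case using assms(1) by (rule jordan_loop_trivial)
  next
    case (Suc i)
    show ?case
      by (rule J_extension.jordan_loop_C[OF J_extension.intro[OF Suc J_extension_axioms.intro[OF assms(2)]]])
  qed
  have ext: "J_extension (A i) (n i) (lab i) (br i) (A (Suc i))" for i
    by (rule J_extension.intro[OF jordan J_extension_axioms.intro[OF assms(2)]])
  have "simple_loop (A i)" for i
    using simple_loop_trivial[OF assms(1)] J_extension.simple_loop_C[OF ext] by (cases i) auto
  moreover have "\<not> associative (A i)" if i: "i \<ge> 2" for i
  proof -
    \<comment> \<open>Two steps back are needed: the first makes the loop nontrivial, the second
      makes it nonassociative.\<close>
    obtain j where "i = Suc (Suc j)"
      using le_Suc_ex[OF i] by auto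
    then show ?thesis
      using J_extension.nonassociative_C[OF ext J_extension.carrier_C_nontrivial[OF ext]] by simp
  qed
  ultimately show ?thesis using jordan by blast
qed

end
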